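(* For Any-Strict Undirected Reachability Graph Realizability there is an infinite family $\mathcal{B}$ of simple digraphs such that for every $D=(V,A)\in\mathcal{B}$ with $n=|V|$ and solid graph $G=(V,E)$ the following hold (with the implicit constants uniform over the family): (1) $G$ is planar; (2) $G$ has a feedback vertex set of size $2$ and its minimum feedback edge set has size $\Theta(n)$; (3) $D$ is realizable, and there is an edge $e\in E$ such that every realization of $D$ assigns $\Omega(n)$ labels to $e$.
   Context: An undirected temporal graph is a pair $(G,\lambda)$ with $G=(V,E)$ a simple undirected graph and $\lambda:E\to 2^{\mathbb{N}}$ assigning each edge a finite, possibly empty, set of labels. A strict temporal path from $u$ to $v$ is a sequence $(e_1,t_1),\dots,(e_\ell,t_\ell)$, $t_j\in\lambda(e_j)$, such that $e_1,\dots,e_\ell$ form a $u$-$v$ path and $t_1<\dots<t_\ell$. The strict reachability graph is the digraph on $V$ with arc $(u,v)$, $u\ne v$, iff a strict temporal path from $u$ to $v$ exists. A realization of a simple digraph $D=(V,A)$ (Any-Strict variant) is a labeling $\lambda$ of the solid graph of $D$ such that the strict reachability graph of the resulting undirected temporal graph equals $D$; $D$ is realizable if one exists. A solid edge of $D$ is a pair $\{u,v\}$ with $(u,v),(v,u)\in A$; the solid graph of $D$ is the undirected graph on $V$ formed by the solid edges. *)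

theory Defs
  imports "HOL-Analysis.Analysis" "Graph_Theory.Pair_Digraph"
begin

text \<open>Simple digraphs are represented by \<^locale>\<open>pair_digraph\<close>: finite, loop-free, arcs are ordered
  pairs of vertices. An edge of an undirected graph is the two-element set of its endpoints.\<close>

record 'a ugraph =
  uverts :: "'a set"
  uedges :: "'a set set"

fun path_edges :: "'a list \<Rightarrow> 'a set list" where
  "path_edges (u # v # p) = {u, v} # path_edges (v # p)"
| "path_edges _ = []"

definition is_upath :: "'a ugraph \<Rightarrow> 'a \<Rightarrow> 'a list \<Rightarrow> 'a \<Rightarrow> bool" where
  "is_upath G u p v \<longleftrightarrow>
     p \<noteq> [] \<and> hd p = u \<and> last p = v \<and> distinct p \<and>
     set p \<subseteq> uverts G \<and> set (path_edges p) \<subseteq> uedges G"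

text \<open>A cycle is given by the list of its vertices, without repeating the first one at the end.\<close>

definition is_ucycle :: "'a ugraph \<Rightarrow> 'a list \<Rightarrow> bool" where
  "is_ucycle G p \<longleftrightarrow>
     3 \<le> length p \<and> distinct p \<and> set p \<subseteq> uverts G \<and>
     set (path_edges p) \<subseteq> uedges G \<and> {last p, hd p} \<in> uedges G"

definition uacyclic :: "'a ugraph \<Rightarrow> bool" where
  "uacyclic G \<longleftrightarrow> (\<nexists>p. is_ucycle G p)"

definition delete_verts :: "'a ugraph \<Rightarrow> 'a set \<Rightarrow> 'a ugraph" where
  "delete_verts G S = \<lparr>uverts = uverts G - S, uedges = {e \<in> uedges G. e \<inter> S = {}}\<rparr>"

definition delete_edges :: "'a ugraph \<Rightarrow> 'a set set \<Rightarrow> 'a ugraph" where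
  "delete_edges G F = \<lparr>uverts = uverts G, uedges = uedges G - F\<rparr>"

definition feedback_vertex_set :: "'a ugraph \<Rightarrow> 'a set \<Rightarrow> bool" where
  "feedback_vertex_set G S \<longleftrightarrow> S \<subseteq> uverts G \<and> uacyclic (delete_verts G S)"

definition feedback_edge_set :: "'a ugraph \<Rightarrow> 'a set set \<Rightarrow> bool" where
  "feedback_edge_set G F \<longleftrightarrow> F \<subseteq> uedges G \<and> uacyclic (delete_edges G F)"

definition feedback_edge_number :: "'a ugraph \<Rightarrow> nat" where
  "feedback_edge_number G = (LEAST k. \<exists>F. feedback_edge_set G F \<and> card F = k)"

text \<open>A plane drawing: \<open>pos\<close> places the vertices at distinct points, \<open>\<gamma> e\<close> is a simple arc joining
  the endpoints of \<open>e\<close> that passes through no other vertex, and two arcs meet only in common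
  endpoints.\<close>

definition plane_drawing ::
    "'a ugraph \<Rightarrow> ('a \<Rightarrow> real \<times> real) \<Rightarrow> ('a set \<Rightarrow> real \<Rightarrow> real \<times> real) \<Rightarrow> bool" where
  "plane_drawing G pos \<gamma> \<longleftrightarrow>
     inj_on pos (uverts G) \<and>
     (\<forall>e \<in> uedges G.
        arc (\<gamma> e) \<and>
        {pathstart (\<gamma> e), pathfinish (\<gamma> e)} = pos ` e \<and>
        path_image (\<gamma> e) \<inter> pos ` uverts G = pos ` e) \<and>
     (\<forall>e \<in> uedges G. \<forall>e' \<in> uedges G. e \<noteq> e' \<longrightarrow>
        path_image (\<gamma> e) \<inter> path_image (\<gamma> e') = pos ` (e \<inter> e'))"

definition planar :: "'a ugraph \<Rightarrow> bool" where
  "planar G \<longleftrightarrow> (\<exists>pos \<gamma>. plane_drawing G pos \<gamma>)"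

definition solid_graph :: "'a pair_pre_digraph \<Rightarrow> 'a ugraph" where
  "solid_graph D =
     \<lparr>uverts = pverts D, uedges = {{u, v} | u v. (u, v) \<in> parcs D \<and> (v, u) \<in> parcs D}\<rparr>"

text \<open>Only the values of a labeling on the edges of the graph matter.\<close>

definition is_labeling :: "'a ugraph \<Rightarrow> ('a set \<Rightarrow> nat set) \<Rightarrow> bool" where
  "is_labeling G lam \<longleftrightarrow> (\<forall>e \<in> uedges G. finite (lam e))"

definition strict_temporal_path ::
    "'a ugraph \<Rightarrow> ('a set \<Rightarrow> nat set) \<Rightarrow> 'a \<Rightarrow> ('a set \<times> nat) list \<Rightarrow> 'a \<Rightarrow> bool" where
  "strict_temporal_path G lam u es v \<longleftrightarrow>
     (\<exists>p. is_upath G u p v \<and> map fst es = path_edges p) \<and>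
     (\<forall>(e, t) \<in> set es. t \<in> lam e) \<and>
     sorted_wrt (<) (map snd es)"

definition strict_reachability_graph ::
    "'a ugraph \<Rightarrow> ('a set \<Rightarrow> nat set) \<Rightarrow> 'a pair_pre_digraph" where
  "strict_reachability_graph G lam =
     \<lparr>pverts = uverts G,
      parcs = {(u, v). u \<in> uverts G \<and> v \<in> uverts G \<and> u \<noteq> v \<and>
                       (\<exists>es. strict_temporal_path G lam u es v)}\<rparr>"

definition is_realization :: "'a pair_pre_digraph \<Rightarrow> ('a set \<Rightarrow> nat set) \<Rightarrow> bool" where
  "is_realization D lam \<longleftrightarrow>
     is_labeling (solid_graph D) lam \<and> strict_reachability_graph (solid_graph D) lam = D"

definition realizable :: "'a pair_pre_digraph \<Rightarrow> bool" where
  "realizable D \<longleftrightarrow> (\<exists>lam. is_realization D lam)"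

end

theory Submission
  imports Defs
begin

text \<open>The digraph has two hubs, joined in both directions to each other and to every leaf; the leaves
  carry a strict partial order that stacks \<open>k\<close> copies of the poset \<open>2+2\<close> (two incomparable chains of
  length two), each copy entirely below the next. In any realization a copy of \<open>2+2\<close> forces one of
  its chains to use labels only towards one hub and the other chain only towards the other hub: if two
  chains shared a hub, interleaving their labels would create a forbidden reachability. Hence no leaf
  can serve as a bridge between the hubs, and a leaf at hub \<open>0\<close> reaches a leaf of the next copy at
  hub \<open>1\<close> only through a label of the edge joining the hubs. Incomparability within a copy
  separates the labels used for consecutive copies, so \<open>k - 1\<close> different labels are needed.\<close>

section \<open>The family\<close>

text \<open>The second disjunct relates only the two members \<open>2 * j\<close> and
  \<open>2 * j + 1\<close> of one chain; leaves of different chains in the same copy stay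
  incomparable.\<close>

definition leaf_less :: "nat \<Rightarrow> nat \<Rightarrow> bool" where
  "leaf_less u v \<longleftrightarrow> u div 4 < v div 4 \<or> (u div 2 = v div 2 \<and> u < v)"

text \<open>The hubs are \<open>0\<close> and \<open>1\<close>. A leaf \<open>v\<close> belongs to the copy \<open>v div 4\<close> of \<open>2+2\<close>, and
  within it to the chain \<open>v div 2\<close>; starting the leaves at \<open>4\<close> aligns the copies with the multiples
  of \<open>4\<close>.\<close>

definition hub_verts :: "nat \<Rightarrow> nat set" where
  "hub_verts k = {0, 1} \<union> {4..<4 * k + 4}"

definition hub_digraph :: "nat \<Rightarrow> nat pair_pre_digraph" where
  "hub_digraph k =
     \<lparr>pverts = hub_verts k,
      parcs = {(u, v). u \<in> hub_verts k \<and> v \<in> hub_verts k \<and> u \<noteq> v \<and>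
                       (u < 2 \<or> v < 2 \<or> leaf_less u v)}\<rparr>"

abbreviation hub_graph :: "nat \<Rightarrow> nat ugraph" where
  "hub_graph k \<equiv> solid_graph (hub_digraph k)"

lemma leaf_less_asym: "leaf_less u v \<Longrightarrow> \<not> leaf_less v u"
  by (auto simp: leaf_less_def)

lemma hub_verts_cases:
  assumes "v \<in> hub_verts k"
  obtains "v = 0" | "v = 1" | "4 \<le> v" "v < 4 * k + 4"
  using assms by (auto simp: hub_verts_def)

lemma hub_in_hub_verts: "h < 2 \<Longrightarrow> h \<in> hub_verts k"
  by (auto simp: hub_verts_def)

lemma card_hub_verts: "card (hub_verts k) = 4 * k + 2"
proof -
  have "card (hub_verts k) = card {0, 1 :: nat} + card {4..<4 * k + 4}"
    unfolding hub_verts_def by (rule card_Un_disjoint) auto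
  then show ?thesis by simp
qed

lemma finite_hub_verts: "finite (hub_verts k)"
  by (simp add: hub_verts_def)

lemma pverts_hub_digraph [simp]: "pverts (hub_digraph k) = hub_verts k"
  by (simp add: hub_digraph_def)

lemma parcs_hub_digraph:
  "parcs (hub_digraph k) = {(u, v). u \<in> hub_verts k \<and> v \<in> hub_verts k \<and> u \<noteq> v \<and>
                                    (u < 2 \<or> v < 2 \<or> leaf_less u v)}"
  by (simp add: hub_digraph_def)

lemma pair_digraph_hub_digraph: "pair_digraph (hub_digraph k)"
proof
  show "finite (parcs (hub_digraph k))"
    by (rule finite_subset[of _ "hub_verts k \<times> hub_verts k"])
      (auto simp: hub_digraph_def finite_hub_verts)
qed (auto simp: hub_digraph_def finite_hub_verts)

lemma uverts_hub_graph [simp]: "uverts (hub_graph k) = hub_verts k"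
  by (simp add: solid_graph_def)

text \<open>Arcs at a hub come in both directions, whereas \<open>leaf_less\<close> is asymmetric
  and so no arc between leaves has a reverse. The solid graph is therefore two adjacent hubs, each
  joined to all leaves.\<close>

lemma hub_edge_iff:
  "{u, v} \<in> uedges (hub_graph k) \<longleftrightarrow>
     u \<in> hub_verts k \<and> v \<in> hub_verts k \<and> u \<noteq> v \<and> (u < 2 \<or> v < 2)"
  using leaf_less_asym[of u v]
  by (auto simp: solid_graph_def hub_digraph_def doubleton_eq_iff)

lemma uedges_hub_graph:
  "uedges (hub_graph k) = {{h, v} | h v. h < 2 \<and> v \<in> hub_verts k \<and> h < v}" (is "_ = ?R")
proof
  show "uedges (hub_graph k) \<subseteq> ?R"
  proof
    fix e assume e: "e \<in> uedges (hub_graph k)"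
    then obtain u v where uv: "e = {u, v}" by (auto simp: solid_graph_def)
    with e have *: "u \<in> hub_verts k" "v \<in> hub_verts k" "u \<noteq> v" "u < 2 \<or> v < 2"
      by (auto simp: hub_edge_iff)
    show "e \<in> ?R"
    proof (cases "u < v")
      case True
      moreover have "u < 2" using True * by auto
      ultimately show ?thesis using * uv by blast
    next
      case False
      then have "v < u" "v < 2" using * by auto
      then show ?thesis using * uv by (auto simp: insert_commute)
    qed
  qed
  show "?R \<subseteq> uedges (hub_graph k)"
    by (auto simp: hub_edge_iff hub_in_hub_verts)
qed

section \<open>Planarity and feedback sets\<close>

text \<open>A straight-line drawing: the leaves lie on the positive vertical axis and the hubs on
  either side of it.\<close>

definition hub_pos :: "nat \<Rightarrow> real \<times> real" where
  "hub_pos v = (if v = 0 then (-1, 0) else if v = 1 then (1, 0) else (0, real v))"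

text \<open>An edge is an unordered pair, so \<open>Min\<close> and \<open>Max\<close> fix a
  direction for its segment.\<close>

definition hub_arc :: "nat set \<Rightarrow> real \<Rightarrow> real \<times> real" where
  "hub_arc e = linepath (hub_pos (Min e)) (hub_pos (Max e))"

lemma path_image_hub_arc:
  assumes "h < v"
  shows "path_image (hub_arc {h, v}) =
    {((1 - s) * fst (hub_pos h) + s * fst (hub_pos v),
      (1 - s) * snd (hub_pos h) + s * snd (hub_pos v)) | s. 0 \<le> s \<and> s \<le> 1}"
proof -
  have "Min {h, v} = h" "Max {h, v} = v" using assms by auto
  then show ?thesis
    unfolding hub_arc_def path_image_linepath closed_segment_def
    by (auto simp: prod_eq_iff)
qed

lemma path_image_hub_arc_01: "path_image (hub_arc {0, 1}) = {(2 * s - 1, 0) | s. 0 \<le> s \<and> s \<le> 1}"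
  by (subst path_image_hub_arc) (auto simp: hub_pos_def algebra_simps)

lemma path_image_hub_arc_0:
  "4 \<le> v \<Longrightarrow> path_image (hub_arc {0, v}) = {(s - 1, s * real v) | s. 0 \<le> s \<and> s \<le> 1}"
  by (subst path_image_hub_arc) (auto simp: hub_pos_def algebra_simps)

lemma path_image_hub_arc_1:
  "4 \<le> v \<Longrightarrow> path_image (hub_arc {1, v}) = {(1 - s, s * real v) | s. 0 \<le> s \<and> s \<le> 1}"
  by (subst path_image_hub_arc) (auto simp: hub_pos_def algebra_simps)

lemma inj_hub_pos: "inj hub_pos"
  by (auto simp: inj_def hub_pos_def split: if_splits)

lemma hub_edge_cases:
  assumes "e \<in> uedges (hub_graph k)"
  obtains "e = {0, 1}" | v where "e = {0, v}" "4 \<le> v" | v where "e = {1, v}" "4 \<le> v"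
proof -
  obtain h v where "e = {h, v}" "h < 2" "v \<in> hub_verts k" "h < v"
    using assms by (auto simp: uedges_hub_graph)
  then show ?thesis
    by (elim hub_verts_cases) (use that in \<open>auto simp: less_2_cases_iff\<close>)
qed

lemma hub_pos_simps:
  "hub_pos 0 = (-1, 0)" "hub_pos (Suc 0) = (1, 0)" "4 \<le> v \<Longrightarrow> hub_pos v = (0, real v)"
  by (auto simp: hub_pos_def)

lemma hub_arc_ends:
  assumes "e \<in> uedges (hub_graph k)"
  shows "arc (hub_arc e)" "{pathstart (hub_arc e), pathfinish (hub_arc e)} = hub_pos ` e"
proof -
  obtain h v where e: "e = {h, v}" "h < v"
    using assms by (auto simp: uedges_hub_graph)
  then have "hub_pos h \<noteq> hub_pos v" using inj_hub_pos by (auto dest: injD)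
  with e show "arc (hub_arc e)" "{pathstart (hub_arc e), pathfinish (hub_arc e)} = hub_pos ` e"
    by (simp_all add: hub_arc_def max_def min_def)
qed

lemma hub_pos_in_arc:
  assumes "e \<in> uedges (hub_graph k)"
  shows "hub_pos ` e \<subseteq> path_image (hub_arc e)"
  unfolding hub_arc_ends(2)[OF assms, symmetric]
  by (simp add: pathstart_in_path_image pathfinish_in_path_image)

text \<open>Segments from one hub to different leaves have different slopes. Segments from different
  hubs to leaves lie on opposite sides of the vertical axis and can meet only there, at their leaf
  ends. The segment between the hubs is on the horizontal axis, which a leaf edge touches only at
  its hub.\<close>

lemma hub_arcs_meet:
  assumes e: "e \<in> uedges (hub_graph k)" and e': "e' \<in> uedges (hub_graph k)" and "e \<noteq> e'"
  shows "path_image (hub_arc e) \<inter> path_image (hub_arc e') = hub_pos ` (e \<inter> e')"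
proof
  show "hub_pos ` (e \<inter> e') \<subseteq> path_image (hub_arc e) \<inter> path_image (hub_arc e')"
    using hub_pos_in_arc[OF e] hub_pos_in_arc[OF e'] by blast
  show "path_image (hub_arc e) \<inter> path_image (hub_arc e') \<subseteq> hub_pos ` (e \<inter> e')"
    using \<open>e \<noteq> e'\<close>
    by (rule_tac hub_edge_cases[OF e]; rule_tac hub_edge_cases[OF e'])
      (auto simp: path_image_hub_arc_01 path_image_hub_arc_0 path_image_hub_arc_1
        path_image_hub_arc_01[simplified] path_image_hub_arc_1[simplified] hub_pos_simps)
qed

lemma hub_arc_verts:
  assumes e: "e \<in> uedges (hub_graph k)"
  shows "path_image (hub_arc e) \<inter> hub_pos ` hub_verts k = hub_pos ` e"
proof
  have "e \<subseteq> hub_verts k" using e by (auto simp: uedges_hub_graph hub_in_hub_verts)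
  then show "hub_pos ` e \<subseteq> path_image (hub_arc e) \<inter> hub_pos ` hub_verts k"
    using hub_pos_in_arc[OF e] by blast
  show "path_image (hub_arc e) \<inter> hub_pos ` hub_verts k \<subseteq> hub_pos ` e"
    by (rule hub_edge_cases[OF e])
      (auto simp: path_image_hub_arc_01 path_image_hub_arc_0 path_image_hub_arc_1
        path_image_hub_arc_01[simplified] path_image_hub_arc_1[simplified] hub_pos_simps
        elim!: hub_verts_cases)
qed

lemma planar_hub_graph: "planar (hub_graph k)"
proof -
  have "plane_drawing (hub_graph k) hub_pos hub_arc"
    using hub_arcs_meet hub_arc_verts hub_arc_ends inj_on_subset[OF inj_hub_pos]
    by (auto simp: plane_drawing_def)
  then show ?thesis by (auto simp: planar_def)
qed

section \<open>Feedback vertex sets and feedback edge sets\<close>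

lemma feedback_vertex_set_hubs: "feedback_vertex_set (hub_graph k) {0, 1}"
proof -
  have "uedges (delete_verts (hub_graph k) {0, 1}) = {}"
    by (auto simp: delete_verts_def elim!: hub_edge_cases)
  then show ?thesis
    by (auto simp: feedback_vertex_set_def uacyclic_def is_ucycle_def hub_verts_def)
qed

lemma uacyclic_no_edges: "uacyclic (delete_edges G (uedges G))"
  by (auto simp: uacyclic_def is_ucycle_def delete_edges_def)

lemma feedback_edge_number_attained:
  obtains F where "feedback_edge_set G F" "card F = feedback_edge_number G"
proof -
  \<comment> \<open>Deleting all edges leaves no cycle, so the minimum ranges over a nonempty
    set.\<close>
  have "\<exists>k F. feedback_edge_set G F \<and> card F = k"
    using uacyclic_no_edges by (auto simp: feedback_edge_set_def)
  then show ?thesis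
    using that LeastI_ex[of "\<lambda>k. \<exists>F. feedback_edge_set G F \<and> card F = k"]
    unfolding feedback_edge_number_def by blast
qed

lemma finite_hub_edges: "finite (uedges (hub_graph k))"
  by (rule finite_subset[of _ "Pow (hub_verts k)"])
    (auto simp: uedges_hub_graph finite_hub_verts hub_in_hub_verts)

lemma card_hub_edges: "card (uedges (hub_graph k)) \<le> 2 * (4 * k + 2)"
proof -
  have "uedges (hub_graph k) \<subseteq> (\<lambda>(h, v). {h, v}) ` ({..<2} \<times> hub_verts k)"
    by (auto simp: uedges_hub_graph)
  then have "card (uedges (hub_graph k)) \<le> card ({..<2 :: nat} \<times> hub_verts k)"
    by (intro surj_card_le[where f = "\<lambda>(h, v). {h, v}"]) (auto simp: finite_hub_verts)
  then show ?thesis by (simp add: card_cartesian_product card_hub_verts)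
qed

lemma feedback_edge_number_hub_upper: "feedback_edge_number (hub_graph k) \<le> 2 * (4 * k + 2)"
proof -
  have "feedback_edge_set (hub_graph k) (uedges (hub_graph k))"
    by (simp add: feedback_edge_set_def uacyclic_no_edges)
  then have "feedback_edge_number (hub_graph k) \<le> card (uedges (hub_graph k))"
    unfolding feedback_edge_number_def by (auto intro: Least_le)
  then show ?thesis using card_hub_edges order_trans by blast
qed

text \<open>The two leaves of a chain and the two hubs form a 4-cycle. The \<open>2 * k\<close>
  cycles obtained this way are edge-disjoint, so a feedback edge set contains an edge of each. A
  chain is indexed by \<open>i = v div 2\<close>, which runs from \<open>2\<close> because the
  leaves start at \<open>4\<close>.\<close>

lemma feedback_edge_number_hub_lower: "2 * k \<le> feedback_edge_number (hub_graph k)"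
proof -
  obtain F where F: "feedback_edge_set (hub_graph k) F"
    and card: "card F = feedback_edge_number (hub_graph k)"
    using feedback_edge_number_attained by metis
  have "\<exists>f\<in>F. \<exists>h<2. \<exists>v. f = {h, v} \<and> v div 2 = i" if i: "i \<in> {2..<2 * k + 2}" for i
  proof (rule ccontr)
    assume neg: "\<not> ?thesis"
    have in_del: "{h, v} \<in> uedges (delete_edges (hub_graph k) F)" if "h < 2" "v div 2 = i" for h v
    proof -
      have "{h, v} \<notin> F" using neg that by blast
      moreover have "4 \<le> v" "v < 4 * k + 4" using i that by auto
      then have "{h, v} \<in> uedges (hub_graph k)"
        using that by (auto simp: hub_edge_iff hub_verts_def)
      ultimately show ?thesis by (simp add: delete_edges_def)
    qed
    have "is_ucycle (delete_edges (hub_graph k) F) [0, 2 * i, 1, 2 * i + 1]"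
      using i in_del[of 0 "2 * i"] in_del[of 1 "2 * i"] in_del[of 1 "2 * i + 1"] in_del[of 0 "2 * i + 1"]
      by (auto simp: is_ucycle_def insert_commute delete_edges_def hub_verts_def)
    then show False using F by (auto simp: feedback_edge_set_def uacyclic_def)
  qed
  then obtain f where f: "\<And>i. i \<in> {2..<2 * k + 2} \<Longrightarrow>
      f i \<in> F \<and> (\<exists>h<2. \<exists>v. f i = {h, v} \<and> v div 2 = i)"
    by metis
  have "inj_on f {2..<2 * k + 2}"
  proof (rule inj_onI)
    fix i j assume ij: "i \<in> {2..<2 * k + 2}" "j \<in> {2..<2 * k + 2}" and eq: "f i = f j"
    obtain h v h' v' where "f i = {h, v}" "v div 2 = i" "h < 2"
      and "f j = {h', v'}" "v' div 2 = j" "h' < 2"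
      using f[OF ij(1)] f[OF ij(2)] by blast
    moreover have "{h, v} = {h', v'}" using calculation eq by simp
    ultimately show "i = j"
      using ij by (auto simp: doubleton_eq_iff)
  qed
  moreover have "f ` {2..<2 * k + 2} \<subseteq> F" using f by blast
  moreover have "finite F"
    using F finite_hub_edges finite_subset by (auto simp: feedback_edge_set_def)
  ultimately have "card {2..<2 * k + 2} \<le> card F" by (rule card_inj_on_le)
  then show ?thesis by (simp add: card)
qed

section \<open>Temporal paths between leaves\<close>

abbreviation reaches :: "nat \<Rightarrow> (nat set \<Rightarrow> nat set) \<Rightarrow> nat \<Rightarrow> nat \<Rightarrow> bool" where
  "reaches k lam u v \<equiv> \<exists>es. strict_temporal_path (hub_graph k) lam u es v"

lemma reaches_edge:
  assumes "{u, v} \<in> uedges (hub_graph k)" "t \<in> lam {u, v}"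
  shows "reaches k lam u v"
proof
  have "is_upath (hub_graph k) u [u, v] v"
    using assms by (auto simp: is_upath_def hub_edge_iff)
  then show "strict_temporal_path (hub_graph k) lam u [({u, v}, t)] v"
    using assms unfolding strict_temporal_path_def by (intro conjI exI[of _ "[u, v]"]) auto
qed

lemma reaches_two_edges:
  assumes "{u, w} \<in> uedges (hub_graph k)" "{w, v} \<in> uedges (hub_graph k)" "u \<noteq> v"
    and "s \<in> lam {u, w}" "t \<in> lam {w, v}" "s < t"
  shows "reaches k lam u v"
proof
  have "is_upath (hub_graph k) u [u, w, v] v"
    using assms by (auto simp: is_upath_def hub_edge_iff)
  then show "strict_temporal_path (hub_graph k) lam u [({u, w}, s), ({w, v}, t)] v"
    using assms unfolding strict_temporal_path_def by (intro conjI exI[of _ "[u, w, v]"]) auto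
qed

lemma reaches_three_edges:
  assumes "{u, w} \<in> uedges (hub_graph k)" "{w, z} \<in> uedges (hub_graph k)"
    and "{z, v} \<in> uedges (hub_graph k)" "distinct [u, w, z, v]"
    and "s \<in> lam {u, w}" "t \<in> lam {w, z}" "r \<in> lam {z, v}" "s < t" "t < r"
  shows "reaches k lam u v"
proof
  have "is_upath (hub_graph k) u [u, w, z, v] v"
    using assms by (auto simp: is_upath_def hub_edge_iff)
  then show "strict_temporal_path (hub_graph k) lam u [({u, w}, s), ({w, z}, t), ({z, v}, r)] v"
    using assms unfolding strict_temporal_path_def by (intro conjI exI[of _ "[u, w, z, v]"]) auto
qed

text \<open>No two leaves are adjacent, so a path between leaves alternates with hubs except where
  it uses the edge between the hubs. With only two hubs available it has at most five vertices. For
  \<open>h < 2\<close> the other hub is \<open>1 - h\<close>.\<close>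

lemma leaf_path_cases:
  assumes p: "is_upath (hub_graph k) u p v" and "4 \<le> u" "4 \<le> v" "u \<noteq> v"
  obtains h where "h < 2" "p = [u, h, v]"
  | h where "h < 2" "p = [u, h, 1 - h, v]"
  | h m where "h < 2" "4 \<le> m" "m < 4 * k + 4" "p = [u, h, m, 1 - h, v]"
proof -
  have V: "set p \<subseteq> hub_verts k" and dist: "distinct p" and "p \<noteq> []" "hd p = u" "last p = v"
    and E: "set (path_edges p) \<subseteq> uedges (hub_graph k)"
    using p by (auto simp: is_upath_def)
  then obtain h q where q: "p = u # h # q"
    using \<open>u \<noteq> v\<close> by (cases p rule: path_edges.cases) auto
  with E \<open>4 \<le> u\<close> have h: "h < 2" by (auto simp: hub_edge_iff)
  obtain w q' where q': "q = w # q'"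
    using q h \<open>last p = v\<close> \<open>4 \<le> v\<close> by (cases q) auto
  have w: "w \<in> hub_verts k" "w \<noteq> h" using V dist q q' by auto
  show ?thesis
  proof (cases "w < 2")
    case True
    then have w1: "w = 1 - h" using w h by auto
    obtain z r where z: "q' = z # r"
      using q q' True \<open>last p = v\<close> \<open>4 \<le> v\<close> by (cases q') auto
    then have "z \<in> hub_verts k" "z \<noteq> h" "z \<noteq> 1 - h" using V dist q q' w1 by auto
    then have "4 \<le> z" using h by (elim hub_verts_cases) auto
    \<comment> \<open>A further vertex after the leaf \<open>z\<close> would be a third hub.\<close>
    have "r = []"
    proof (cases r)
      case (Cons z' r')
      then have "z' < 2" using E q q' z \<open>4 \<le> z\<close> by (auto simp: hub_edge_iff)
      moreover have "z' \<noteq> h" "z' \<noteq> 1 - h" using dist q q' z Cons w1 by auto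
      ultimately show ?thesis using h by auto
    qed
    then show ?thesis using that(2)[of h] h q q' z w1 \<open>last p = v\<close> by auto
  next
    case False
    then have w4: "4 \<le> w" "w < 4 * k + 4" using w by (auto elim: hub_verts_cases)
    show ?thesis
    proof (cases q')
      case Nil
      then show ?thesis using that(1)[of h] h q q' \<open>last p = v\<close> by auto
    next
      case (Cons z r)
      then have "z < 2" using E q q' w4 by (auto simp: hub_edge_iff)
      moreover have "z \<noteq> h" using dist q q' Cons by auto
      ultimately have z: "z = 1 - h" using h by auto
      obtain y r' where y: "r = y # r'"
        using q q' Cons \<open>z < 2\<close> \<open>last p = v\<close> \<open>4 \<le> v\<close> by (cases r) auto
      then have "y \<in> hub_verts k" "y \<noteq> h" "y \<noteq> 1 - h" using V dist q q' Cons z by auto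
      then have "4 \<le> y" using h by (elim hub_verts_cases) auto
      have "r' = []"
      proof (cases r')
        case (Cons y' r'')
        then have "y' < 2" using E q q' \<open>q' = z # r\<close> y \<open>4 \<le> y\<close> by (auto simp: hub_edge_iff)
        moreover have "y' \<noteq> h" "y' \<noteq> 1 - h" using dist q q' \<open>q' = z # r\<close> y Cons z by auto
        ultimately show ?thesis using h by auto
      qed
      then show ?thesis using that(3)[of h w] h w4 q q' Cons z y \<open>last p = v\<close> by auto
    qed
  qed
qed

text \<open>In the last case, \<open>s < t\<close> lets \<open>u\<close> reach \<open>m\<close>
  through hub \<open>h\<close>, and \<open>r < w\<close> lets \<open>m\<close> reach
  \<open>v\<close> through the other hub. This will place the bridge \<open>m\<close> between
  \<open>u\<close> and \<open>v\<close> in the order.\<close>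

lemma leaf_reaches_cases:
  assumes "reaches k lam u v" and "4 \<le> u" "4 \<le> v" "u \<noteq> v"
  obtains h s t where "h < 2" "s \<in> lam {h, u}" "t \<in> lam {h, v}" "s < t"
  | h s t r where "h < 2" "s \<in> lam {h, u}" "t \<in> lam {0, 1}" "r \<in> lam {1 - h, v}" "s < t" "t < r"
  | h m s t r w where "h < 2" "4 \<le> m" "m < 4 * k + 4" "m \<noteq> u" "m \<noteq> v"
      "s \<in> lam {h, u}" "t \<in> lam {h, m}" "r \<in> lam {1 - h, m}" "w \<in> lam {1 - h, v}" "s < t" "r < w"
proof -
  obtain es p where p: "is_upath (hub_graph k) u p v" and es: "map fst es = path_edges p"
    and lam: "\<forall>(e, t) \<in> set es. t \<in> lam e" and srt: "sorted_wrt (<) (map snd es)"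
    using assms(1) by (auto simp: strict_temporal_path_def)
  show ?thesis
    using p assms(2-4)
  proof (cases rule: leaf_path_cases)
    case (1 h)
    with es obtain s t where es': "es = [({u, h}, s), ({h, v}, t)]"
      by (auto simp: map_eq_Cons_conv)
    have "s \<in> lam {u, h}" "t \<in> lam {h, v}" "s < t" using lam srt unfolding es' by simp_all
    then show ?thesis using that(1)[of h s t] 1(1) insert_commute[of u h] by metis
  next
    case (2 h)
    with es obtain s t r where es': "es = [({u, h}, s), ({h, 1 - h}, t), ({1 - h, v}, r)]"
      by (auto simp: map_eq_Cons_conv)
    have "s \<in> lam {u, h}" "t \<in> lam {h, 1 - h}" "r \<in> lam {1 - h, v}" "s < t" "t < r"
      using lam srt unfolding es' by simp_all
    moreover have "{h, 1 - h} = {0, 1}" using 2(1) by (auto simp: less_2_cases_iff)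
    ultimately show ?thesis using that(2)[of h s t r] 2(1) insert_commute[of u h] by metis
  next
    case (3 h m)
    with es obtain s t r w where
      es': "es = [({u, h}, s), ({h, m}, t), ({m, 1 - h}, r), ({1 - h, v}, w)]"
      by (auto simp: map_eq_Cons_conv)
    have "s \<in> lam {u, h}" "t \<in> lam {h, m}" "r \<in> lam {m, 1 - h}" "w \<in> lam {1 - h, v}" "s < t" "r < w"
      using lam srt unfolding es' by simp_all
    moreover have "m \<noteq> u" "m \<noteq> v" using p 3(4) by (auto simp: is_upath_def)
    ultimately show ?thesis
      using that(3)[of h m s t r w] 3(1-3) insert_commute[of m "1 - h"] insert_commute[of u h]
      by metis
  qed
qed

section \<open>A realization\<close>

text \<open>All even chains are attached to hub \<open>0\<close> and all odd ones to hub \<open>1\<close>; the copy \<open>g\<close> uses the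
  labels \<open>3 * g + 1\<close> and \<open>3 * g + 2\<close>, and the multiples of \<open>3\<close> are the labels of the edge between
  the hubs.\<close>

definition leaf_hub :: "nat \<Rightarrow> nat" where
  "leaf_hub v = v div 2 mod 2"

definition leaf_time :: "nat \<Rightarrow> nat" where
  "leaf_time v = 3 * (v div 4) + 1 + v mod 2"

definition hub_lam :: "nat \<Rightarrow> nat set \<Rightarrow> nat set" where
  "hub_lam k e = (if e = {0, 1} then {3 * i | i. i \<le> k + 1}
                  else {leaf_time v | v. 4 \<le> v \<and> e = {leaf_hub v, v}})"

lemma leaf_hub_less: "leaf_hub v < 2"
  by (simp add: leaf_hub_def)

section \<open>Correctness of the labeling\<close>

lemma hub_lam_leaf:
  assumes "h < 2" "4 \<le> v"
  shows "hub_lam k {h, v} = (if h = leaf_hub v then {leaf_time v} else {})"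
proof -
  have "{h, v} = {leaf_hub w, w} \<longleftrightarrow> h = leaf_hub v \<and> w = v" if "4 \<le> w" for w
    using assms that leaf_hub_less[of w] leaf_hub_less[of v] by (auto simp: doubleton_eq_iff)
  moreover have "{h, v} \<noteq> {0, 1}" using assms by (auto simp: doubleton_eq_iff)
  ultimately show ?thesis using assms(2) by (auto simp: hub_lam_def)
qed

lemma hub_lam_hubs: "hub_lam k {0, 1} = {3 * i | i. i \<le> k + 1}"
  by (simp add: hub_lam_def)

text \<open>Leaves at a common hub and in a common copy belong to the same chain. On such leaves
  \<open>leaf_time\<close> is the lexicographic order by copy and then by parity, which is exactly
  the order of the leaves.\<close>

lemma leaf_less_same_hub:
  assumes "leaf_hub u = leaf_hub v"
  shows "leaf_time u < leaf_time v \<longleftrightarrow> leaf_less u v"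
proof -
  have "w div 2 = 2 * (w div 4) + leaf_hub w" for w
    unfolding leaf_hub_def by presburger
  from this[of u] this[of v] have "u div 2 = v div 2 \<longleftrightarrow> u div 4 = v div 4" using assms by simp
  moreover have "u = 2 * (u div 2) + u mod 2" "v = 2 * (v div 2) + v mod 2" by simp_all
  then have "u < v \<longleftrightarrow> u mod 2 < v mod 2" if "u div 2 = v div 2" using that by linarith
  moreover have "u mod 2 < 2" "v mod 2 < 2" by simp_all
  ultimately show ?thesis unfolding leaf_time_def leaf_less_def by auto
qed

lemma leaf_less_other_hub:
  assumes "leaf_hub u \<noteq> leaf_hub v"
  shows "leaf_less u v \<longleftrightarrow> u div 4 < v div 4"
  using assms unfolding leaf_hub_def leaf_less_def by auto

lemma hub_lam_reaches_imp_leaf_less: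
  assumes "reaches k (hub_lam k) u v" "4 \<le> u" "4 \<le> v" "u \<noteq> v"
  shows "leaf_less u v"
  using assms
proof (cases rule: leaf_reaches_cases)
  case (1 h s t)
  then show ?thesis
    using assms leaf_less_same_hub[of u v] by (auto simp: hub_lam_leaf split: if_splits)
next
  case (2 h s t r)
  then have "leaf_time u < t" "t < leaf_time v"
    using assms by (auto simp: hub_lam_leaf split: if_splits)
  moreover obtain i where "t = 3 * i" using 2 unfolding hub_lam_hubs by blast
  \<comment> \<open>The labels of copy \<open>g\<close> lie strictly between \<open>3 * g\<close>
    and \<open>3 * (g + 1)\<close>, so a multiple of \<open>3\<close> between two leaf times
    separates their copies.\<close>
  ultimately have "u div 4 < v div 4" unfolding leaf_time_def by linarith
  then show ?thesis by (simp add: leaf_less_def)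
next
  case (3 h m s t r w)
  \<comment> \<open>A bridge would need labels towards both hubs, but each leaf has them towards one
    only.\<close>
  then have "h = leaf_hub m" "1 - h = leaf_hub m" by (auto simp: hub_lam_leaf split: if_splits)
  then have False by arith
  then show ?thesis ..
qed

lemma hub_lam_reaches_hub:
  assumes "h < 2" "4 \<le> v" "v \<in> hub_verts k"
  shows "reaches k (hub_lam k) h v" "reaches k (hub_lam k) v h"
proof -
  have edge: "{g, v} \<in> uedges (hub_graph k)" "{v, g} \<in> uedges (hub_graph k)" if "g < 2" for g
    using assms that by (auto simp: hub_edge_iff hub_in_hub_verts)
  have vk: "v div 4 \<le> k" using assms by (elim hub_verts_cases) auto
  have lab: "leaf_time v \<in> hub_lam k {leaf_hub v, v}" "leaf_time v \<in> hub_lam k {v, leaf_hub v}"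
    using assms hub_lam_leaf[OF leaf_hub_less, of v k v] by (simp_all add: insert_commute)
  have "reaches k (hub_lam k) h v \<and> reaches k (hub_lam k) v h"
  proof (cases "h = leaf_hub v")
    case True
    then show ?thesis
      using reaches_edge[of "leaf_hub v" v k _ "hub_lam k"] reaches_edge[of v "leaf_hub v" k _ "hub_lam k"]
        edge[OF leaf_hub_less] lab by blast
  next
    case False
    have hub_edge: "{h, leaf_hub v} = {0, 1}" "{leaf_hub v, h} = {0, 1}"
      using False leaf_hub_less[of v] assms(1) by (auto simp: less_2_cases_iff)
    then have e: "{h, leaf_hub v} \<in> uedges (hub_graph k)" "{leaf_hub v, h} \<in> uedges (hub_graph k)"
      by (auto simp: hub_edge_iff hub_verts_def)
    have "reaches k (hub_lam k) h v"
    proof (rule reaches_two_edges[OF e(1) edge(1)[OF leaf_hub_less]])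
      \<comment> \<open>Label \<open>0\<close> crosses to the other hub before any leaf
        time.\<close>
      show "3 * 0 \<in> hub_lam k {h, leaf_hub v}"
        unfolding hub_edge hub_lam_hubs by blast
      show "3 * 0 < leaf_time v" by (simp add: leaf_time_def)
    qed (use lab assms in auto)
    moreover have "reaches k (hub_lam k) v h"
    proof (rule reaches_two_edges[OF edge(2)[OF leaf_hub_less] e(2)])
      \<comment> \<open>Label \<open>3 * (k + 1)\<close> crosses after every leaf time; this is why
        the labels of the hub edge run up to index \<open>k + 1\<close>.\<close>
      show "3 * (k + 1) \<in> hub_lam k {leaf_hub v, h}"
        unfolding hub_edge hub_lam_hubs by blast
      show "leaf_time v < 3 * (k + 1)" using vk by (simp add: leaf_time_def)
    qed (use lab assms in auto)
    ultimately show ?thesis ..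
  qed
  then show "reaches k (hub_lam k) h v" "reaches k (hub_lam k) v h" by auto
qed

lemma hub_lam_reaches_leaf:
  assumes "leaf_less u v" "4 \<le> u" "4 \<le> v" "u \<in> hub_verts k" "v \<in> hub_verts k"
  shows "reaches k (hub_lam k) u v"
proof -
  have "u \<noteq> v" using assms(1) by (auto simp: leaf_less_def)
  have eu: "{u, leaf_hub u} \<in> uedges (hub_graph k)"
    using assms leaf_hub_less[of u] by (auto simp: hub_edge_iff hub_in_hub_verts)
  have ev: "{leaf_hub v, v} \<in> uedges (hub_graph k)"
    using assms leaf_hub_less[of v] by (auto simp: hub_edge_iff hub_in_hub_verts)
  have lu: "leaf_time u \<in> hub_lam k {u, leaf_hub u}"
    using assms hub_lam_leaf[OF leaf_hub_less, of u k u] by (simp add: insert_commute)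
  have lv: "leaf_time v \<in> hub_lam k {leaf_hub v, v}"
    using assms by (simp add: hub_lam_leaf leaf_hub_less)
  show ?thesis
  proof (cases "leaf_hub u = leaf_hub v")
    case True
    then show ?thesis
      using reaches_two_edges[of u "leaf_hub u" k v "leaf_time u" "hub_lam k" "leaf_time v"]
        eu ev lu lv \<open>u \<noteq> v\<close> leaf_less_same_hub[OF True] assms(1) by simp
  next
    case False
    then have less: "u div 4 < v div 4" using assms(1) leaf_less_other_hub by simp
    have vk: "v div 4 \<le> k" using assms by (elim hub_verts_cases[of v]) auto
    have hub_edge: "{leaf_hub u, leaf_hub v} = {0, 1}"
      using False leaf_hub_less[of u] leaf_hub_less[of v] by (auto simp: less_2_cases_iff)
    show ?thesis
    proof (rule reaches_three_edges[OF eu _ ev _ lu _ lv])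
      show "{leaf_hub u, leaf_hub v} \<in> uedges (hub_graph k)"
        unfolding hub_edge by (simp add: hub_edge_iff hub_verts_def)
      show "distinct [u, leaf_hub u, leaf_hub v, v]"
        using False \<open>u \<noteq> v\<close> assms leaf_hub_less[of u] leaf_hub_less[of v] by auto
      have "v div 4 \<le> k + 1" using vk by simp
      \<comment> \<open>The crossing takes place immediately before the times of the copy of
        \<open>v\<close>, hence after those of every earlier copy.\<close>
      then show "3 * (v div 4) \<in> hub_lam k {leaf_hub u, leaf_hub v}"
        unfolding hub_edge hub_lam_hubs by blast
      show "leaf_time u < 3 * (v div 4)" "3 * (v div 4) < leaf_time v"
        using less by (auto simp: leaf_time_def)
    qed
  qed
qed

lemma hub_lam_is_realization: "is_realization (hub_digraph k) (hub_lam k)"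
proof -
  have "finite (hub_lam k e)" if "e \<in> uedges (hub_graph k)" for e
    using that
  proof (cases rule: hub_edge_cases)
    case 1
    then show ?thesis by (simp add: hub_lam_hubs[simplified])
  qed (simp_all add: hub_lam_leaf[of 0] hub_lam_leaf[of 1, simplified])
  moreover have "reaches k (hub_lam k) u v \<longleftrightarrow> u < 2 \<or> v < 2 \<or> leaf_less u v"
    if uv: "u \<in> hub_verts k" "v \<in> hub_verts k" "u \<noteq> v" for u v
  proof -
    have "u < 2 \<or> 4 \<le> u" "v < 2 \<or> 4 \<le> v" using uv by (auto elim!: hub_verts_cases)
    then consider "u < 2" "v < 2" | "u < 2" "4 \<le> v" | "4 \<le> u" "v < 2" | "4 \<le> u" "4 \<le> v" by blast
    then show ?thesis
    proof cases
      case 1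
      then have e: "{u, v} = {0, 1}" using uv(3) by (auto simp: less_2_cases_iff)
      have "3 * 0 \<in> hub_lam k {u, v}" unfolding e hub_lam_hubs by blast
      moreover have "{u, v} \<in> uedges (hub_graph k)" using 1 uv by (simp add: hub_edge_iff)
      ultimately show ?thesis using 1 reaches_edge by blast
    next
      case 4
      then show ?thesis
        using hub_lam_reaches_imp_leaf_less[OF _ 4 uv(3)] hub_lam_reaches_leaf[OF _ 4 uv(1,2)] by auto
    qed (use hub_lam_reaches_hub uv in auto)
  qed
  ultimately have "is_labeling (hub_graph k) (hub_lam k)"
    and "parcs (strict_reachability_graph (hub_graph k) (hub_lam k)) = parcs (hub_digraph k)"
    by (auto simp: is_labeling_def strict_reachability_graph_def parcs_hub_digraph)
  then show ?thesis
    by (simp add: is_realization_def strict_reachability_graph_def pair_pre_digraph.equality)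
qed

section \<open>Labels forced on the edge between the hubs\<close>

locale hub_realization =
  fixes k :: nat and lam :: "nat set \<Rightarrow> nat set"
  assumes realization: "is_realization (hub_digraph k) lam"
begin

abbreviation leaf :: "nat \<Rightarrow> bool" where
  "leaf v \<equiv> 4 \<le> v \<and> v < 4 * k + 4"

lemma reaches_iff_leaf_less:
  assumes "leaf u" "leaf v" "u \<noteq> v"
  shows "reaches k lam u v \<longleftrightarrow> leaf_less u v"
proof -
  have V: "u \<in> hub_verts k" "v \<in> hub_verts k" using assms by (auto simp: hub_verts_def)
  have "(u, v) \<in> parcs (strict_reachability_graph (hub_graph k) lam) \<longleftrightarrow> reaches k lam u v"
    using V assms by (simp add: strict_reachability_graph_def)
  moreover have "(u, v) \<in> parcs (hub_digraph k) \<longleftrightarrow> leaf_less u v"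
    using V assms by (simp add: hub_digraph_def)
  ultimately show ?thesis using realization by (simp add: is_realization_def)
qed

lemma leaf_hub_edge: "leaf v \<Longrightarrow> h < 2 \<Longrightarrow> {h, v} \<in> uedges (hub_graph k)"
  by (auto simp: hub_edge_iff hub_verts_def)

lemma leaf_less_if_direct:
  assumes "leaf u" "leaf v" "u \<noteq> v" "h < 2" "s \<in> lam {h, u}" "t \<in> lam {h, v}" "s < t"
  shows "leaf_less u v"
proof -
  have "reaches k lam u v"
    using assms(3,5-7) leaf_hub_edge[OF assms(1,4)] leaf_hub_edge[OF assms(2,4)]
    by (intro reaches_two_edges[of u h k v s lam t]) (simp_all add: insert_commute[of u h])
  then show ?thesis using assms reaches_iff_leaf_less by blast
qed

lemma leaf_less_if_across:
  assumes "leaf u" "leaf v" "u \<noteq> v" "h < 2"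
    and "s \<in> lam {h, u}" "t \<in> lam {0, 1}" "r \<in> lam {1 - h, v}" "s < t" "t < r"
  shows "leaf_less u v"
proof -
  have hub_edge: "{h, 1 - h} = {0, 1}" using \<open>h < 2\<close> by (auto simp: less_2_cases_iff)
  have "reaches k lam u v"
  proof (rule reaches_three_edges[of u h k "1 - h" v s lam t r])
    show "{u, h} \<in> uedges (hub_graph k)" "{1 - h, v} \<in> uedges (hub_graph k)"
      using leaf_hub_edge[of u h] leaf_hub_edge[of v "1 - h"] assms(1,2,4)
      by (simp_all only: insert_commute[of u h])
    show "{h, 1 - h} \<in> uedges (hub_graph k)"
      unfolding hub_edge by (simp add: hub_edge_iff hub_verts_def)
    show "t \<in> lam {h, 1 - h}" unfolding hub_edge by (rule assms(6))
    show "s \<in> lam {u, h}" using assms(5) by (simp only: insert_commute[of u h])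
    have "h \<noteq> 1 - h" by arith
    then show "distinct [u, h, 1 - h, v]" using assms(1-4) by auto
  qed (use assms in auto)
  then show ?thesis using assms reaches_iff_leaf_less by blast
qed

text \<open>Each order relation is witnessed by one of the three shapes of temporal paths. Both
  halves of a bridge path are direct connections, so a bridge leaf lies strictly between
  \<open>u\<close> and \<open>v\<close> in the order.\<close>

lemma leaf_less_cases:
  assumes "leaf_less u v" "leaf u" "leaf v"
  obtains (direct) h s t where "h < 2" "s \<in> lam {h, u}" "t \<in> lam {h, v}" "s < t"
  | (across) h s t r where
      "h < 2" "s \<in> lam {h, u}" "t \<in> lam {0, 1}" "r \<in> lam {1 - h, v}" "s < t" "t < r"
  | (bridge) h m where "h < 2" "leaf m" "lam {h, m} \<noteq> {}" "lam {1 - h, m} \<noteq> {}"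
      "leaf_less u m" "leaf_less m v"
proof -
  have "u \<noteq> v" using assms by (auto simp: leaf_less_def)
  then have "reaches k lam u v" "4 \<le> u" "4 \<le> v" "u \<noteq> v"
    using assms reaches_iff_leaf_less by blast+
  then show ?thesis
  proof (cases rule: leaf_reaches_cases)
    case (1 h s t)
    then show ?thesis by (rule direct)
  next
    case (2 h s t r)
    then show ?thesis by (rule across)
  next
    case (3 h m s t r w)
    then have "leaf m" "1 - h < 2" by simp_all
    then have "leaf_less u m" "leaf_less m v"
      using leaf_less_if_direct[of u m h s t] leaf_less_if_direct[of m v "1 - h" r w] assms 3 by blast+
    then show ?thesis using bridge[of h m] 3 \<open>leaf m\<close> by blast
  qed
qed

section \<open>A copy of 2+2 puts its two chains on different hubs\<close>

definition incomparable_chains :: "nat \<Rightarrow> nat \<Rightarrow> nat \<Rightarrow> nat \<Rightarrow> bool" where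
  "incomparable_chains a a' b b' \<longleftrightarrow>
     leaf a \<and> leaf a' \<and> leaf b \<and> leaf b' \<and> distinct [a, a', b, b'] \<and>
     leaf_less a a' \<and> leaf_less b b' \<and>
     (\<nexists>m. leaf_less a m \<and> leaf_less m a') \<and> (\<nexists>m. leaf_less b m \<and> leaf_less m b') \<and>
     (\<forall>u \<in> {a, a'}. \<forall>v \<in> {b, b'}. \<not> leaf_less u v \<and> \<not> leaf_less v u)"

lemma incomparable_chains_commute: "incomparable_chains a a' b b' \<Longrightarrow> incomparable_chains b b' a a'"
  by (auto simp: incomparable_chains_def)

text \<open>Since \<open>s < t\<close>, every label \<open>r\<close> satisfies \<open>r < t\<close>
  or \<open>s < r\<close>. If \<open>w\<close> had the label \<open>r\<close> at hub
  \<open>h\<close>, it would thus reach \<open>b'\<close> or be reached from \<open>b\<close>,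
  against incomparability.\<close>

lemma direct_chain_excludes:
  assumes "incomparable_chains a a' b b'" "h < 2"
    and "s \<in> lam {h, b}" "t \<in> lam {h, b'}" "s < t" "w \<in> {a, a'}"
  shows "lam {h, w} = {}"
proof (rule ccontr)
  assume "lam {h, w} \<noteq> {}"
  then obtain r where r: "r \<in> lam {h, w}" by blast
  have "\<not> r < t"
    using leaf_less_if_direct[of w b' h r t] assms r by (auto simp: incomparable_chains_def)
  moreover have "\<not> s < r"
    using leaf_less_if_direct[of b w h s r] assms r by (auto simp: incomparable_chains_def)
  ultimately show False using \<open>s < t\<close> by simp
qed

text \<open>Each chain is a covering relation, so no leaf lies between its members and a bridge is
  impossible.\<close>

lemma incomparable_chains_cases:
  assumes "incomparable_chains a a' b b'"
  obtains (direct) h s t where "h < 2" "s \<in> lam {h, a}" "t \<in> lam {h, a'}" "s < t"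
  | (across) h s t r where
      "h < 2" "s \<in> lam {h, a}" "t \<in> lam {0, 1}" "r \<in> lam {1 - h, a'}" "s < t" "t < r"
proof -
  have "leaf_less a a'" "leaf a" "leaf a'" "\<nexists>m. leaf_less a m \<and> leaf_less m a'"
    using assms by (auto simp: incomparable_chains_def)
  then show ?thesis
    by (cases rule: leaf_less_cases) (use direct across in blast)+
qed

lemma not_both_across:
  assumes chains: "incomparable_chains a a' b b'"
    and a: "h < 2" "s \<in> lam {h, a}" "t \<in> lam {0, 1}" "r \<in> lam {1 - h, a'}" "s < t" "t < r"
    and b: "g < 2" "x \<in> lam {g, b}" "y \<in> lam {0, 1}" "z \<in> lam {1 - g, b'}" "x < y" "y < z"
  shows False
proof (cases "g = h")
  case True
  have "\<not> (s < y \<and> y < z)"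
    using leaf_less_if_across[of a b' h s y z] a b chains True by (auto simp: incomparable_chains_def)
  moreover have "\<not> (x < t \<and> t < r)"
    using leaf_less_if_across[of b a' h x t r] a b chains True by (auto simp: incomparable_chains_def)
  \<comment> \<open>Incomparability gives \<open>y \<le> s\<close> and \<open>t \<le> x\<close>,
    closing the cycle \<open>y \<le> s < t \<le> x < y\<close>.\<close>
  ultimately show False using a b by linarith
next
  case False
  then have "1 - g = h" "1 - h = g" using a(1) b(1) by auto
  then have "z \<in> lam {h, b'}" "r \<in> lam {g, a'}" using a b by simp_all
  then have "\<not> s < z" "\<not> x < r"
    using leaf_less_if_direct[of a b' h s z] leaf_less_if_direct[of b a' g x r] a b chains
    by (auto simp: incomparable_chains_def)
  \<comment> \<open>In opposite directions each chain ends at the hub where the other starts, which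
    yields the cycle \<open>s < t < r \<le> x < y < z \<le> s\<close>.\<close>
  then show False using a b by linarith
qed

text \<open>Serves to refute the mixed case: a direct chain empties one hub for the other chain,
  which then cannot be realized across.\<close>

lemma across_uses_every_hub:
  assumes "h < 2" "g < 2" "s \<in> lam {h, a}" "r \<in> lam {1 - h, a'}"
  shows "lam {g, a} \<noteq> {} \<or> lam {g, a'} \<noteq> {}"
proof -
  have "g = h \<or> g = 1 - h" using assms by auto
  then show ?thesis using assms by blast
qed

text \<open>Two chains across contradict each other, as do a direct one and one across. Two direct
  chains remain; they must use different hubs, and each excludes the other from its own hub.\<close>

lemma incomparable_chains_separate:
  assumes chains: "incomparable_chains a a' b b'"
  obtains h where "h < 2" "lam {1 - h, a} = {}" "lam {1 - h, a'} = {}" "lam {h, b} = {}" "lam {h, b'} = {}"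
  using chains
proof (cases rule: incomparable_chains_cases)
  case (direct h s t)
  then have empty: "lam {h, b} = {}" "lam {h, b'} = {}"
    using direct_chain_excludes[OF incomparable_chains_commute[OF chains] direct] by simp_all
  from incomparable_chains_commute[OF chains] show ?thesis
  proof (cases rule: incomparable_chains_cases)
    case b: (direct g x y)
    then have "g = 1 - h" using empty \<open>h < 2\<close> by (cases "g = h") auto
    then have "lam {1 - h, a} = {}" "lam {1 - h, a'} = {}"
      using direct_chain_excludes[OF chains b] by simp_all
    then show ?thesis using that[of h] empty \<open>h < 2\<close> by blast
  next
    case b: (across g x y z)
    then show ?thesis using across_uses_every_hub[of g h x b z b'] empty \<open>h < 2\<close> by auto
  qed
next
  case a: (across h s t r)
  from incomparable_chains_commute[OF chains] show ?thesis
  proof (cases rule: incomparable_chains_cases)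
    case (direct g x y)
    then have "lam {g, a} = {}" "lam {g, a'} = {}"
      using direct_chain_excludes[OF chains direct] by simp_all
    then show ?thesis using across_uses_every_hub[of h g s a r a'] a direct by auto
  next
    case (across g x y z)
    then show ?thesis using not_both_across[OF chains a] by blast
  qed
qed

section \<open>The copies of 2+2 and the labels between consecutive copies\<close>

lemma incomparable_chains_copy:
  assumes "i \<in> {1..k}"
  shows "incomparable_chains (4 * i) (4 * i + 1) (4 * i + 2) (4 * i + 3)"
proof -
  \<comment> \<open>An element between two leaves of one copy would have to lie in the same chain,
    strictly between two consecutive numbers.\<close>
  have cover: "\<nexists>m. leaf_less c m \<and> leaf_less m c'" if "c' = Suc c" "c' div 4 = c div 4" for c c'
    using that unfolding leaf_less_def by auto
  have div4: "(4 * i + j) div 4 = i" if "j < 4" for j using that by simp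
  have div2: "4 * i div 2 = 2 * i" "(4 * i + 1) div 2 = 2 * i"
    "(4 * i + 2) div 2 = 2 * i + 1" "(4 * i + 3) div 2 = 2 * i + 1"
    by simp_all
  note less = leaf_less_def div2 div4[of 0, simplified] div4[of 1] div4[of 2] div4[of 3]
  have "\<nexists>m. leaf_less (4 * i) m \<and> leaf_less m (4 * i + 1)"
    by (rule cover) simp_all
  moreover have "\<nexists>m. leaf_less (4 * i + 2) m \<and> leaf_less m (4 * i + 3)"
    by (rule cover) simp_all
  moreover have "leaf_less (4 * i) (4 * i + 1)" "leaf_less (4 * i + 2) (4 * i + 3)"
    by (simp_all add: less)
  moreover have "\<forall>u \<in> {4 * i, 4 * i + 1}. \<forall>v \<in> {4 * i + 2, 4 * i + 3}. \<not> leaf_less u v \<and> \<not> leaf_less v u"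
    by (simp add: less) presburger
  ultimately show ?thesis
    using assms unfolding incomparable_chains_def by simp
qed

text \<open>Which chain is on which hub may vary from copy to copy. Naming the leaf on hub
  \<open>0\<close> by \<open>p\<close> and the one on hub \<open>1\<close> by \<open>q\<close> makes
  all later crossings go from hub \<open>0\<close> to hub \<open>1\<close>.\<close>

lemma copy_representatives:
  assumes i: "i \<in> {1..k}"
  obtains p q where "p div 4 = i" "q div 4 = i" "leaf p" "leaf q" "p \<noteq> q" "\<not> leaf_less p q"
    "lam {1, p} = {}" "lam {0, q} = {}"
proof -
  obtain h where h: "h < 2" "lam {1 - h, 4 * i} = {}" "lam {h, 4 * i + 2} = {}"
    using incomparable_chains_separate[OF incomparable_chains_copy[OF i]] by metis
  have chains: "leaf (4 * i)" "leaf (4 * i + 2)" "\<not> leaf_less (4 * i) (4 * i + 2)"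
    "\<not> leaf_less (4 * i + 2) (4 * i)"
    using incomparable_chains_copy[OF i] by (auto simp: incomparable_chains_def)
  have div: "4 * i div 4 = i" "(4 * i + 2) div 4 = i" by auto
  show ?thesis
  proof (cases "h = 0")
    case True
    then show ?thesis using that[of "4 * i" "4 * i + 2"] h chains div by auto
  next
    case False
    then have "h = 1" using h(1) by simp
    then show ?thesis using that[of "4 * i + 2" "4 * i"] h chains div by auto
  qed
qed

text \<open>Every leaf belongs to a chain of some copy, and that chain avoids one hub. Hence bridges
  are impossible also between leaves of different copies.\<close>

lemma leaf_one_hub:
  assumes "leaf m" "h < 2"
  shows "lam {h, m} = {} \<or> lam {1 - h, m} = {}"
proof -
  define i where "i = m div 4"
  have i: "i \<in> {1..k}" using assms(1) by (auto simp: i_def)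
  have "m \<in> {4 * i, 4 * i + 1, 4 * i + 2, 4 * i + 3}" unfolding i_def by auto
  moreover obtain g where g: "g < 2" "lam {1 - g, 4 * i} = {}" "lam {1 - g, 4 * i + 1} = {}"
    "lam {g, 4 * i + 2} = {}" "lam {g, 4 * i + 3} = {}"
    using incomparable_chains_separate[OF incomparable_chains_copy[OF i]] by metis
  moreover have "h = g \<or> h = 1 - g \<and> g = 1 - h" using assms(2) g(1) by auto
  ultimately show ?thesis by auto
qed

lemma card_hub_labels: "k - 1 \<le> card (lam {0, 1})"
proof -
  have "\<exists>p q. p div 4 = i \<and> q div 4 = i \<and> leaf p \<and> leaf q \<and> p \<noteq> q \<and> \<not> leaf_less p q \<and>
      lam {1, p} = {} \<and> lam {0, q} = {}" if "i \<in> {1..k}" for i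
    using copy_representatives[OF that] by metis
  then obtain p q where pq: "\<And>i. i \<in> {1..k} \<Longrightarrow> p i div 4 = i \<and> q i div 4 = i \<and> leaf (p i) \<and>
      leaf (q i) \<and> p i \<noteq> q i \<and> \<not> leaf_less (p i) (q i) \<and> lam {1, p i} = {} \<and> lam {0, q i} = {}"
    by metis
  have "\<exists>t s r. t \<in> lam {0, 1} \<and> s \<in> lam {0, p i} \<and> r \<in> lam {1, q (Suc i)} \<and> s < t \<and> t < r"
    if i: "i \<in> {1..<k}" for i
  proof -
    have p: "p i div 4 = i" "leaf (p i)" "lam {1, p i} = {}"
      and q: "q (Suc i) div 4 = Suc i" "leaf (q (Suc i))" "lam {0, q (Suc i)} = {}"
      using pq[of i] pq[of "Suc i"] i by auto
    then have "leaf_less (p i) (q (Suc i))" by (simp add: leaf_less_def)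
    then show ?thesis
      using p(2) q(2)
    proof (cases rule: leaf_less_cases)
      case (direct h s t)
      \<comment> \<open>A direct path needs a common hub, but \<open>p i\<close> has no labels at
        hub \<open>1\<close> and \<open>q (Suc i)\<close> none at hub \<open>0\<close>.\<close>
      then show ?thesis using p(3) q(3) by (cases "h = 0") (auto simp: less_2_cases_iff)
    next
      case (across h s t r)
      then have "h = 0" using p(3) by (cases "h = 0") (auto simp: less_2_cases_iff)
      then show ?thesis using across by auto
    next
      case (bridge h m)
      then show ?thesis using leaf_one_hub by blast
    qed
  qed
  then obtain \<tau> \<sigma> \<rho> where \<tau>: "\<And>i. i \<in> {1..<k} \<Longrightarrow>
      \<tau> i \<in> lam {0, 1} \<and> \<sigma> i \<in> lam {0, p i} \<and> \<rho> i \<in> lam {1, q (Suc i)} \<and> \<sigma> i < \<tau> i \<and> \<tau> i < \<rho> i"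
    by metis
  have step: "\<tau> i < \<tau> (Suc i)" if "1 \<le> i" "Suc i < k" for i
  proof -
    have \<tau>i: "\<tau> i \<in> lam {0, 1}" "\<rho> i \<in> lam {1, q (Suc i)}" "\<tau> i < \<rho> i"
      and \<tau>j: "\<sigma> (Suc i) \<in> lam {0, p (Suc i)}" "\<sigma> (Suc i) < \<tau> (Suc i)"
      using \<tau>[of i] \<tau>[of "Suc i"] that by auto
    \<comment> \<open>Otherwise \<open>p (Suc i)\<close> could cross at \<open>\<tau> i\<close> and
      reach \<open>q (Suc i)\<close> at \<open>\<rho> i\<close>, although these two leaves of one
      copy are not related. Hence
      \<open>\<tau> i \<le> \<sigma> (Suc i) < \<tau> (Suc i)\<close>.\<close>
    have "\<not> \<sigma> (Suc i) < \<tau> i"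
      using leaf_less_if_across[of "p (Suc i)" "q (Suc i)" 0 "\<sigma> (Suc i)" "\<tau> i" "\<rho> i"]
        pq[of "Suc i"] \<tau>i \<tau>j that by auto
    then show ?thesis using \<tau>j(2) by linarith
  qed
  have mono: "\<tau> i < \<tau> j" if "i < j" "1 \<le> i" "j < k" for i j
    using that
  proof (induction j)
    case (Suc j)
    then show ?case using step[of j] by (cases "i = j") auto
  qed simp
  have "inj_on \<tau> {1..<k}"
    by (rule linorder_inj_onI) (use mono in fastforce)+
  moreover have "\<tau> ` {1..<k} \<subseteq> lam {0, 1}" using \<tau> by blast
  moreover have "{0, 1} \<in> uedges (hub_graph k)" by (simp add: hub_edge_iff hub_verts_def)
  then have "finite (lam {0, 1})"
    using realization by (simp add: is_realization_def is_labeling_def)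
  ultimately have "card {1..<k} \<le> card (lam {0, 1})" by (rule card_inj_on_le)
  then show ?thesis by simp
qed

end

theorem theorem4:
  shows "\<exists>\<B> :: nat pair_pre_digraph set.
    (\<forall>D \<in> \<B>. pair_digraph D) \<and>
    infinite ((\<lambda>D. card (pverts D)) ` \<B>) \<and>
    (\<exists>c\<^sub>1 c\<^sub>2 c\<^sub>3 :: real. 0 < c\<^sub>1 \<and> 0 < c\<^sub>2 \<and> 0 < c\<^sub>3 \<and>
      (\<forall>D \<in> \<B>. let n = card (pverts D); G = solid_graph D in
        planar G \<and>
        (\<exists>S. feedback_vertex_set G S \<and> card S = 2) \<and>
        c\<^sub>1 * real n \<le> real (feedback_edge_number G) \<and>
        real (feedback_edge_number G) \<le> c\<^sub>2 * real n \<and>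
        realizable D \<and>
        (\<exists>e \<in> uedges G. \<forall>lam. is_realization D lam \<longrightarrow> c\<^sub>3 * real n \<le> real (card (lam e)))))"
proof (intro exI conjI ballI)
  \<comment> \<open>For \<open>n = 4 * k + 2\<close> the bound \<open>n / 10 \<le> k - 1\<close>
    holds exactly when \<open>2 \<le> k\<close>.\<close>
  let ?\<B> = "hub_digraph ` {2..}"
  show "pair_digraph D" if "D \<in> ?\<B>" for D
    using that pair_digraph_hub_digraph by blast
  have "(\<lambda>D. card (pverts D)) ` ?\<B> = (\<lambda>k. 4 * k + 2) ` {2..}"
    by (simp add: image_image card_hub_verts)
  moreover have "infinite ((\<lambda>k. 4 * k + 2) ` {2 :: nat..})"
    by (subst finite_image_iff) (auto simp: inj_on_def infinite_Ici)
  ultimately show "infinite ((\<lambda>D. card (pverts D)) ` ?\<B>)" by simp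
  \<comment> \<open>The feedback edge number lies between \<open>2 * k\<close>, which is at least
    \<open>n / 4\<close>, and \<open>2 * n\<close>.\<close>
  show "0 < (1 / 4 :: real)" "0 < (2 :: real)" "0 < (1 / 10 :: real)" by simp_all
  fix D assume "D \<in> ?\<B>"
  then obtain k where D: "D = hub_digraph k" and k: "2 \<le> k" by auto
  have n: "card (pverts D) = 4 * k + 2" by (simp add: D card_hub_verts)
  have labels: "1 / 10 * real (4 * k + 2) \<le> real (card (lam {0, 1}))" if "is_realization D lam" for lam
  proof -
    interpret hub_realization k lam using that D by unfold_locales simp
    have "real k \<le> real (card (lam {0, 1})) + 1" using card_hub_labels by linarith
    then show ?thesis using k by (simp add: field_simps)
  qed
  have edge: "{0, 1} \<in> uedges (hub_graph k)" by (simp add: hub_edge_iff hub_verts_def)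
  have lower: "1 / 4 * real (4 * k + 2) \<le> real (feedback_edge_number (hub_graph k))"
  proof -
    have "real (2 * k) \<le> real (feedback_edge_number (hub_graph k))"
      using feedback_edge_number_hub_lower[of k] of_nat_mono by blast
    then show ?thesis using k by (simp add: field_simps)
  qed
  have upper: "real (feedback_edge_number (hub_graph k)) \<le> 2 * real (4 * k + 2)"
    using of_nat_mono[OF feedback_edge_number_hub_upper[of k], where 'a = real] by simp
  show "let n = card (pverts D); G = solid_graph D in
        planar G \<and>
        (\<exists>S. feedback_vertex_set G S \<and> card S = 2) \<and>
        1 / 4 * real n \<le> real (feedback_edge_number G) \<and>
        real (feedback_edge_number G) \<le> 2 * real n \<and>
        realizable D \<and>
        (\<exists>e \<in> uedges G. \<forall>lam. is_realization D lam \<longrightarrow> 1 / 10 * real n \<le> real (card (lam e)))"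
    unfolding Let_def n
  proof (intro conjI)
    show "\<exists>S. feedback_vertex_set (solid_graph D) S \<and> card S = 2"
      unfolding D using feedback_vertex_set_hubs by (intro exI[of _ "{0, 1}"]) simp
    show "realizable D" unfolding D realizable_def using hub_lam_is_realization by blast
    show "\<exists>e \<in> uedges (solid_graph D). \<forall>lam. is_realization D lam \<longrightarrow>
        1 / 10 * real (4 * k + 2) \<le> real (card (lam e))"
      using labels edge unfolding D by (intro bexI[of _ "{0, 1}"]) auto
  qed (use planar_hub_graph lower upper D in simp_all)
qed

end
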